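(* Let $Q\in\mathbb{F}_q[x]$ be an irreducible polynomial and let $\mathfrak{D}=\deg Q-1$. Then \[ \frac{1}{\phi(Q)}\sum_{\chi\neq\chi_{0}}\left|L\left(\tfrac{1}{2},\chi\right)\right|^{2}=\mathfrak{D}+O(1), \] where the sum is over all nontrivial Dirichlet characters $\chi$ modulo $Q$, and the implied constant depends at most on $q$.
   Context: $\mathbb{F}_q$ is a fixed finite field with $q$ elements and $\mathcal{A}=\mathbb{F}_q[x]$. For nonzero $N\in\mathcal{A}$, $|N|=q^{\deg N}$. $\phi(Q)=\#(\mathcal{A}/Q\mathcal{A})^{*}$. A Dirichlet character modulo $Q$ is a function $\chi:\mathcal{A}\to\mathbb{C}$ with $\chi(A+BQ)=\chi(A)$ and $\chi(AB)=\chi(A)\chi(B)$ for all $A,B\in\mathcal{A}$, and $\chi(A)\neq0$ if and only if $(A,Q)=1$; $\chi_0$ is the trivial character ($\chi_0(A)=1$ whenever $(A,Q)=1$). The L-function is $L(s,\chi)=\sum_{N\text{ monic}}\chi(N)|N|^{-s}$ for $\Re(s)>1$. For $\chi\neq\chi_0$ one has $\sum_{N\text{ monic},\,\deg N=n}\chi(N)=0$ for $n\ge\deg Q$, so $L(s,\chi)$ is a polynomial in $q^{-s}$, which gives its value for all $s$; in particular $L(\tfrac12,\chi)=\sum_{n=0}^{\deg Q-1}q^{-n/2}\sum_{N\text{ monic},\,\deg N=n}\chi(N)$. *)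

theory Defs
  imports "HOL-Analysis.Analysis" "HOL-Computational_Algebra.Computational_Algebra"
    "HOL-Number_Theory.Cong"
begin

text \<open>Throughout, a type \<open>'a :: {field, finite}\<close> is the finite field with \<open>q = CARD('a)\<close> elements,
  and \<open>'a poly\<close> is the polynomial ring over it.\<close>

text \<open>The norm \<open>q ^ degree N\<close>; only used for nonzero \<open>N\<close>.\<close>
definition poly_norm :: "'a :: {field, finite} poly \<Rightarrow> real" where
  "poly_norm N = real CARD('a) ^ degree N"

text \<open>The number of units of the quotient ring modulo \<open>Q\<close>, whose elements are the residue
  classes \<open>C\<close>.\<close>
definition poly_phi :: "'a :: {field, finite} poly \<Rightarrow> nat" where
  "poly_phi Q = card {C \<in> UNIV // {(A, B). [A = B] (mod Q)}. \<exists>A\<in>C. \<exists>B. [A * B = 1] (mod Q)}"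

definition dirichlet_characters :: "'a :: {field, finite} poly \<Rightarrow> ('a poly \<Rightarrow> complex) set" where
  "dirichlet_characters Q = {\<psi>. (\<forall>A B. \<psi> (A + B * Q) = \<psi> A) \<and>
     (\<forall>A B. \<psi> (A * B) = \<psi> A * \<psi> B) \<and> (\<forall>A. \<psi> A \<noteq> 0 \<longleftrightarrow> coprime A Q)}"

definition trivial_character :: "'a :: {field, finite} poly \<Rightarrow> 'a poly \<Rightarrow> complex" where
  "trivial_character Q A = (if coprime A Q then 1 else 0)"

definition dirichlet_L_summand :: "('a :: {field, finite} poly \<Rightarrow> complex) \<Rightarrow> complex \<Rightarrow> 'a poly \<Rightarrow> complex"
  where "dirichlet_L_summand \<psi> s N = \<psi> N * of_real (poly_norm N) powr (- s)"

text \<open>The Dirichlet series on \<open>Re s > 1\<close>. Elsewhere, the value of the unique polynomial in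
  \<open>q powr (- s)\<close> which agrees with the series on \<open>Re s > 1\<close>; this continuation is only meaningful
  for nontrivial \<open>\<psi>\<close>, see \<open>dirichlet_L_eq\<close> below.\<close>
definition dirichlet_L :: "('a :: {field, finite} poly \<Rightarrow> complex) \<Rightarrow> complex \<Rightarrow> complex" where
  "dirichlet_L \<psi> s =
     (if Re s > 1 then (\<Sum>\<^sub>\<infinity>N\<in>{N. lead_coeff N = 1}. dirichlet_L_summand \<psi> s N)
      else poly (THE P. \<forall>z. Re z > 1 \<longrightarrow>
                   (dirichlet_L_summand \<psi> z has_sum poly P (of_nat CARD('a) powr (- z)))
                     {N. lead_coeff N = 1})
             (of_nat CARD('a) powr (- s)))"

lemma card_field_ge_2: "CARD('a :: {field, finite}) \<ge> 2"
proof -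
  have "card {0, 1 :: 'a} \<le> CARD('a)" by (rule card_mono) auto
  thus ?thesis by simp
qed

lemma bij_betw_monic_degree:
  "bij_betw (\<lambda>p :: 'a :: {field, finite} poly. monom 1 n + p) {p. p = 0 \<or> degree p < n}
     {N. lead_coeff N = 1 \<and> degree N = n}"
proof (rule bij_betw_byWitness[where f' = "\<lambda>N. N - monom 1 n"])
  show "(\<lambda>p. monom 1 n + p) ` {p :: 'a poly. p = 0 \<or> degree p < n}
          \<subseteq> {N. lead_coeff N = 1 \<and> degree N = n}"
  proof clarify
    fix p :: "'a poly" assume p: "p = 0 \<or> degree p < n"
    show "lead_coeff (monom 1 n + p) = 1 \<and> degree (monom 1 n + p) = n"
    proof (cases "p = 0")
      case False
      hence lt: "degree p < degree (monom (1::'a) n)" using p by (simp add: degree_monom_eq)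
      thus ?thesis
        by (simp add: degree_add_eq_left degree_monom_eq coeff_eq_0)
    qed (simp add: degree_monom_eq)
  qed
  show "(\<lambda>N. N - monom 1 n) ` {N :: 'a poly. lead_coeff N = 1 \<and> degree N = n}
          \<subseteq> {p. p = 0 \<or> degree p < n}"
  proof clarify
    fix N :: "'a poly"
    assume N: "lead_coeff N = 1" "n = degree N" "\<not> degree (N - monom 1 (degree N)) < degree N"
    show "N - monom 1 (degree N) = 0"
    proof (rule ccontr)
      assume nz: "N - monom 1 (degree N) \<noteq> 0"
      have "degree (N - monom 1 (degree N)) \<le> degree N"
        by (rule degree_diff_le) (auto simp: degree_monom_le)
      with N have "degree (N - monom 1 (degree N)) = degree N" by simp
      hence "lead_coeff (N - monom 1 (degree N)) = 0" using N by simp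
      thus False using nz leading_coeff_0_iff by blast
    qed
  qed
qed auto

lemma degree_less_finite_card:
  "finite {p :: 'a :: {field, finite} poly. p = 0 \<or> degree p < n}" (is ?A)
  "card {p :: 'a poly. p = 0 \<or> degree p < n} = CARD('a) ^ n" (is ?B)
proof -
  let ?L = "{xs :: 'a list. set xs \<subseteq> UNIV \<and> length xs = n}"
  have b: "bij_betw (\<lambda>p :: 'a poly. map (coeff p) [0..<n]) {p. p = 0 \<or> degree p < n} ?L"
  proof (rule bij_betw_byWitness[where f' = Poly])
    have "coeff (Poly (map (coeff p) [0..<n])) i = coeff p i" if "p = 0 \<or> degree p < n"
      for p :: "'a poly" and i
      using that by (auto simp: nth_default_def coeff_eq_0)
    thus "\<forall>p\<in>{p :: 'a poly. p = 0 \<or> degree p < n}. Poly (map (coeff p) [0..<n]) = p"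
      by (auto intro!: poly_eqI)
    show "\<forall>xs\<in>?L. map (coeff (Poly xs)) [0..<n] = xs"
      by (auto intro!: nth_equalityI simp: nth_default_def)
    have "Poly xs = 0 \<or> degree (Poly xs) < length xs" for xs :: "'a list"
    proof (rule disjCI)
      assume "\<not> degree (Poly xs) < length xs"
      hence "lead_coeff (Poly xs) = 0" by (simp add: nth_default_def)
      thus "Poly xs = 0" using leading_coeff_0_iff by blast
    qed
    thus "Poly ` ?L \<subseteq> {p. p = 0 \<or> degree p < n}" by auto
  qed auto
  have "finite ?L" by (rule finite_lists_length_eq) simp
  thus ?A using bij_betw_finite[OF b] by blast
  show ?B using bij_betw_same_card[OF b] by (simp only: card_lists_length_eq finite_class.finite_UNIV)
qed

lemma monic_degree_finite_card:
  "finite {N :: 'a :: {field, finite} poly. lead_coeff N = 1 \<and> degree N = n}"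
  "card {N :: 'a poly. lead_coeff N = 1 \<and> degree N = n} = CARD('a) ^ n"
  using bij_betw_finite[OF bij_betw_monic_degree[where 'a = 'a, of n]]
    bij_betw_same_card[OF bij_betw_monic_degree[where 'a = 'a, of n]]
    degree_less_finite_card[where 'a = 'a, of n] by simp_all

lemma range_mod_poly:
  assumes "Q \<noteq> (0 :: 'a :: {field, finite} poly)"
  shows "range (\<lambda>A. A mod Q) = {p. p = 0 \<or> degree p < degree Q}"
proof (intro equalityI subsetI)
  fix p assume "p \<in> range (\<lambda>A. A mod Q)"
  thus "p \<in> {p. p = 0 \<or> degree p < degree Q}" using degree_mod_less[OF assms] by auto
next
  fix p :: "'a poly" assume "p \<in> {p. p = 0 \<or> degree p < degree Q}"
  hence "p mod Q = p" by (auto simp: mod_poly_less)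
  thus "p \<in> range (\<lambda>A. A mod Q)" by (metis rangeI)
qed

lemma finite_range_mod_poly:
  assumes "Q \<noteq> (0 :: 'a :: {field, finite} poly)"
  shows "finite (range (\<lambda>A. A mod Q))"
  using range_mod_poly[OF assms] degree_less_finite_card(1)[of "degree Q"] by simp

lemma coprime_bezout_poly:
  fixes A B :: "'a :: field poly"
  assumes "coprime A B"
  shows "\<exists>U V. U * A + V * B = 1"
  using assms
proof (induction "if B = 0 then 0 else Suc (degree B)" arbitrary: A B rule: less_induct)
  case less
  show ?case
  proof (cases "B = 0")
    case True
    hence "A dvd 1" using less.prems by simp
    then obtain U where "1 = A * U" by (elim dvdE)
    hence "U * A + 0 * B = 1" by (simp add: mult.commute)
    thus ?thesis by blast
  next
    case False
    have "coprime B (A mod B)"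
    proof (rule coprimeI)
      fix C assume "C dvd B" "C dvd A mod B"
      thus "is_unit C" using less.prems dvd_mod_iff[of C B A] by (auto intro: coprime_common_divisor)
    qed
    moreover have "(if A mod B = 0 then 0 else Suc (degree (A mod B))) <
                   (if B = 0 then 0 else Suc (degree B))"
      using degree_mod_less[OF False, of A] False by auto
    ultimately obtain U V where UV: "U * B + V * (A mod B) = 1"
      using less.hyps by blast
    have "V * A + (U - V * (A div B)) * B = U * B + V * (A - (A div B) * B)"
      by (simp add: algebra_simps)
    also have "A - (A div B) * B = A mod B" by (simp add: minus_div_mult_eq_mod)
    finally show ?thesis using UV by metis
  qed
qed

lemma coprime_dvd_mult_poly:
  fixes A B C :: "'a :: field poly"
  assumes "coprime B Q" "Q dvd B * C"
  shows "Q dvd C"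
proof -
  obtain U V where "U * B + V * Q = 1" using coprime_bezout_poly[OF assms(1)] by blast
  hence "C = (U * B + V * Q) * C" by simp
  also have "\<dots> = U * (B * C) + Q * (V * C)" by (simp add: algebra_simps)
  finally show ?thesis using assms(2) by (metis dvd_add dvd_mult dvd_triv_left)
qed

context
  fixes Q :: "'a :: {field, finite} poly" and \<psi> :: "'a poly \<Rightarrow> complex"
  assumes chi: "\<psi> \<in> dirichlet_characters Q" and Q0: "Q \<noteq> 0"
begin

lemma character_mult: "\<psi> (A * B) = \<psi> A * \<psi> B"
  and character_nz_iff: "\<psi> A \<noteq> 0 \<longleftrightarrow> coprime A Q"
  and character_add: "\<psi> (A + B * Q) = \<psi> A"
  using chi by (auto simp: dirichlet_characters_def)

lemma character_mod: "\<psi> (A mod Q) = \<psi> A"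
  using character_add[of "A mod Q" "A div Q"] by (simp add: add.commute)

lemma character_one: "\<psi> 1 = 1"
  using character_mult[of 1 1] character_nz_iff[of 1] by simp

lemma character_power: "\<psi> (A ^ n) = \<psi> A ^ n"
  by (induction n) (auto simp: character_one character_mult)

lemma character_root_of_unity:
  assumes "coprime A Q"
  shows "\<psi> A ^ fact (card (range (\<lambda>A :: 'a poly. A mod Q))) = 1"
proof -
  let ?F = "range (\<lambda>A :: 'a poly. A mod Q)"
  have "\<not> inj_on (\<lambda>i. A ^ i mod Q) {..card ?F}"
  proof
    assume "inj_on (\<lambda>i. A ^ i mod Q) {..card ?F}"
    hence "card {..card ?F} \<le> card ?F"
      by (rule card_inj_on_le) (use finite_range_mod_poly[OF Q0] in auto)
    thus False by simp
  qed
  then obtain i j where "i \<noteq> j" "i \<le> card ?F" "j \<le> card ?F" "A ^ i mod Q = A ^ j mod Q"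
    by (auto simp: inj_on_def)
  then obtain i j where ij: "i < j" "j \<le> card ?F" "A ^ i mod Q = A ^ j mod Q"
    by (metis linorder_neqE_nat)
  have nz: "\<psi> A \<noteq> 0" using assms character_nz_iff by simp
  have "\<psi> A ^ i = \<psi> A ^ j" using ij(3) character_power character_mod by metis
  also have "\<psi> A ^ j = \<psi> A ^ i * \<psi> A ^ (j - i)" using ij(1) by (simp flip: power_add)
  finally have 1: "\<psi> A ^ (j - i) = 1" using nz by simp
  have "j - i dvd fact (card ?F)" by (rule dvd_fact) (use ij in auto)
  then obtain k where "fact (card ?F) = (j - i) * k" by (auto elim: dvdE)
  thus ?thesis using 1 by (simp add: power_mult)
qed

lemma norm_character_le: "norm (\<psi> A) \<le> 1"
proof (cases "coprime A Q")
  case True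
  define k :: nat where "k = fact (card (range (\<lambda>A :: 'a poly. A mod Q)))"
  have k: "k > 0" by (simp add: k_def)
  have "\<psi> A ^ k = 1" unfolding k_def by (rule character_root_of_unity[OF True])
  hence 1: "norm (\<psi> A) ^ k = 1" by (metis norm_one norm_power)
  show ?thesis
  proof (rule ccontr)
    assume "\<not> norm (\<psi> A) \<le> 1"
    hence "1 < norm (\<psi> A) ^ k" using k by (intro one_less_power) auto
    thus False using 1 by simp
  qed
next
  case False
  hence "\<psi> A = 0" using character_nz_iff[of A] by blast
  thus ?thesis by simp
qed

lemma sum_character_residues:
  assumes "\<psi> \<noteq> trivial_character Q"
  shows "(\<Sum>R\<in>range (\<lambda>A. A mod Q). \<psi> R) = 0"
proof -
  let ?F = "range (\<lambda>A :: 'a poly. A mod Q)"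
  obtain B where "\<psi> B \<noteq> trivial_character Q B" using assms by auto
  hence B: "coprime B Q" "\<psi> B \<noteq> 1"
    using character_nz_iff[of B] by (auto simp: trivial_character_def split: if_splits)
  have inj: "inj_on (\<lambda>R. (B * R) mod Q) ?F"
  proof (rule inj_onI)
    fix R S assume RS: "R \<in> ?F" "S \<in> ?F" "B * R mod Q = B * S mod Q"
    hence "Q dvd B * (R - S)" by (simp add: mod_eq_dvd_iff right_diff_distrib)
    hence "Q dvd R - S" using B(1) by (rule coprime_dvd_mult_poly[rotated])
    hence "R mod Q = S mod Q" by (simp add: mod_eq_dvd_iff)
    thus "R = S" using RS by auto
  qed
  have img: "(\<lambda>R. (B * R) mod Q) ` ?F = ?F"
    by (rule card_subset_eq) (use finite_range_mod_poly[OF Q0] inj in \<open>auto simp: card_image\<close>)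
  have "(\<Sum>R\<in>?F. \<psi> R) = (\<Sum>R\<in>?F. \<psi> ((B * R) mod Q))"
    using sum.reindex[OF inj, of \<psi>] by (simp only: img o_def)
  also have "\<dots> = \<psi> B * (\<Sum>R\<in>?F. \<psi> R)"
    by (simp add: character_mod character_mult sum_distrib_left)
  finally show ?thesis using B(2) by simp
qed

lemma sum_character_monic:
  assumes "\<psi> \<noteq> trivial_character Q" "n \<ge> degree Q"
  shows "(\<Sum>N | lead_coeff N = 1 \<and> degree N = n. \<psi> N) = 0"
proof -
  let ?F = "range (\<lambda>A :: 'a poly. A mod Q)"
  let ?M = "{N :: 'a poly. lead_coeff N = 1 \<and> degree N = n}"
  have fib: "(\<Sum>N\<in>{N\<in>?M. N div Q = D}. \<psi> N) = 0" if D: "D \<in> (\<lambda>N. N div Q) ` ?M" for D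
  proof -
    obtain N0 where N0: "lead_coeff N0 = 1" "degree N0 = n" "N0 div Q = D" using D by auto
    have N0nz: "N0 \<noteq> 0" using N0 by auto
    have img: "{N\<in>?M. N div Q = D} = (\<lambda>R. D * Q + R) ` ?F"
    proof (intro equalityI subsetI)
      fix N assume "N \<in> {N\<in>?M. N div Q = D}"
      hence "N = D * Q + N mod Q" by auto
      thus "N \<in> (\<lambda>R. D * Q + R) ` ?F" by blast
    next
      fix N assume "N \<in> (\<lambda>R. D * Q + R) ` ?F"
      then obtain A where N: "N = D * Q + A mod Q" by auto
      have dv: "N div Q = D" using Q0 by (simp add: N)
      define E where "E = A mod Q - N0 mod Q"
      have NE: "N = N0 + E" using N N0(3) by (simp add: E_def algebra_simps)
          (metis add.commute div_mult_mod_eq mult.commute)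
      have "E = E mod Q" by (simp add: E_def poly_mod_diff_left)
      hence "E = 0 \<or> degree E < degree Q" using degree_mod_less[OF Q0, of E] by metis
      hence "E = 0 \<or> degree E < degree N0" using assms(2) N0(2) by auto
      hence "degree N = degree N0 \<and> lead_coeff N = lead_coeff N0"
        unfolding NE by (auto simp: degree_add_eq_left coeff_eq_0)
      hence "degree N = n" "lead_coeff N = 1" using N0 by metis+
      thus "N \<in> {N\<in>?M. N div Q = D}" using dv by blast
    qed
    have "(\<Sum>N\<in>{N\<in>?M. N div Q = D}. \<psi> N) = (\<Sum>R\<in>?F. \<psi> (D * Q + R))"
      unfolding img by (subst sum.reindex) (auto simp: inj_on_def)
    also have "\<dots> = (\<Sum>R\<in>?F. \<psi> R)"
      using character_add by (metis add.commute)
    finally show ?thesis using sum_character_residues[OF assms(1)] by simp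
  qed
  have "(\<Sum>N\<in>?M. \<psi> N) = (\<Sum>D\<in>(\<lambda>N. N div Q) ` ?M. \<Sum>N\<in>{N\<in>?M. N div Q = D}. \<psi> N)"
    by (rule sum.image_gen) (rule monic_degree_finite_card)
  thus ?thesis using fib by simp
qed

end

lemma finite_dirichlet_characters:
  assumes "Q \<noteq> (0 :: 'a :: {field, finite} poly)"
  shows "finite (dirichlet_characters Q)"
proof -
  let ?F = "range (\<lambda>A :: 'a poly. A mod Q)"
  let ?Z = "insert 0 {z :: complex. z ^ fact (card ?F) = 1}"
  have fin: "finite (PiE ?F (\<lambda>_. ?Z))"
    by (rule finite_PiE) (use finite_range_mod_poly[OF assms] in \<open>auto intro!: finite_roots_unity\<close>)
  have "dirichlet_characters Q \<subseteq> (\<lambda>f A. f (A mod Q)) ` PiE ?F (\<lambda>_. ?Z)"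
  proof
    fix \<psi> assume chi: "\<psi> \<in> dirichlet_characters Q"
    have "\<psi> = (\<lambda>A. restrict \<psi> ?F (A mod Q))"
      using character_mod[OF chi assms] by auto
    moreover have "restrict \<psi> ?F \<in> PiE ?F (\<lambda>_. ?Z)"
      using character_root_of_unity[OF chi assms] character_nz_iff[OF chi assms] by auto
    ultimately show "\<psi> \<in> (\<lambda>f A. f (A mod Q)) ` PiE ?F (\<lambda>_. ?Z)" by blast
  qed
  thus ?thesis using fin finite_subset by blast
qed

lemma poly_norm_powr:
  "of_real (poly_norm (N :: 'a :: {field, finite} poly)) powr (- s)
     = (of_nat CARD('a) powr (- s) :: complex) ^ degree N"
proof -
  have q: "real CARD('a) > 0" by simp
  have "of_real (poly_norm N) powr (- s) = exp (- s * of_real (ln (real CARD('a) ^ degree N)))"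
    using q by (simp add: powr_def poly_norm_def flip: of_real_power Ln_of_real)
  also have "ln (real CARD('a) ^ degree N) = degree N * ln (real CARD('a))"
    using q by (simp add: ln_realpow)
  also have "exp (- s * of_real \<dots>) = exp (- s * Ln (of_real (real CARD('a)))) ^ degree N"
    using q by (subst Ln_of_real) (auto simp: mult_ac simp flip: exp_of_nat_mult)
  finally show ?thesis by (simp add: powr_def)
qed

lemma norm_q_powr:
  "norm (of_nat CARD('a :: {field, finite}) powr (- s) :: complex) = real CARD('a) powr (- Re s)"
  using norm_powr_real_powr[of "of_nat CARD('a)" "- s"] by simp

lemma dirichlet_L_summand_has_sum:
  fixes Q :: "'a :: {field, finite} poly"
  assumes "\<psi> \<in> dirichlet_characters Q" "\<psi> \<noteq> trivial_character Q" "Q \<noteq> 0" "Re s > 1"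
  shows "(dirichlet_L_summand \<psi> s has_sum
           (\<Sum>n<degree Q. (of_nat CARD('a) powr (- s)) ^ n * (\<Sum>N | lead_coeff N = 1 \<and> degree N = n. \<psi> N)))
           {N. lead_coeff N = 1}"
proof -
  define u :: complex where "u = of_nat CARD('a) powr (- s)"
  define M where "M = (\<lambda>n. {N :: 'a poly. lead_coeff N = 1 \<and> degree N = n})"
  let ?f = "dirichlet_L_summand \<psi> s"
  have q2: "real CARD('a) \<ge> 2" using card_field_ge_2[where 'a = 'a] by simp
  have nf: "norm (?f N) \<le> norm u ^ degree N" for N
    unfolding dirichlet_L_summand_def poly_norm_powr u_def[symmetric] norm_mult norm_power
    using norm_character_le[OF assms(1,3), of N] by (simp add: mult_left_le_one_le)
  define r where "r = real CARD('a) * norm u"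
  have "r = real CARD('a) powr (1 - Re s)"
    unfolding r_def u_def norm_q_powr using q2 by (simp add: powr_diff powr_minus field_simps)
  also have "\<dots> < real CARD('a) powr 0" using q2 assms(4) by (intro powr_less_mono) auto
  finally have r: "0 \<le> r" "r < 1" using q2 by (auto simp: r_def)
  have finM: "finite (M n)" for n unfolding M_def by (rule monic_degree_finite_card)
  have cardM: "card (M n) = CARD('a) ^ n" for n unfolding M_def by (rule monic_degree_finite_card)
  have abs: "(\<lambda>N. norm (?f N)) summable_on {N. lead_coeff N = 1}"
  proof (rule nonneg_bdd_above_summable_on)
    show "bdd_above (sum (\<lambda>N. norm (?f N)) ` {F. F \<subseteq> {N. lead_coeff N = 1} \<and> finite F})"
    proof (rule bdd_aboveI2)
      fix F assume "F \<in> {F. F \<subseteq> {N :: 'a poly. lead_coeff N = 1} \<and> finite F}"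
      hence F: "F \<subseteq> {N. lead_coeff N = 1}" "finite F" by auto
      define K where "K = Suc (Max (insert 0 (degree ` F)))"
      have sub: "F \<subseteq> (\<Union>n<K. M n)"
      proof
        fix N assume "N \<in> F"
        hence "degree N < K" using F(2) by (auto simp: K_def less_Suc_eq_le intro!: Max_ge)
        thus "N \<in> (\<Union>n<K. M n)" using \<open>N \<in> F\<close> F(1) by (auto simp: M_def)
      qed
      have "(\<Sum>N\<in>F. norm (?f N)) \<le> (\<Sum>N\<in>(\<Union>n<K. M n). norm (?f N))"
        by (rule sum_mono2) (use sub finM in auto)
      also have "\<dots> = (\<Sum>n<K. \<Sum>N\<in>M n. norm (?f N))"
        by (rule sum.UNION_disjoint) (use finM in \<open>auto simp: M_def\<close>)
      also have "\<dots> \<le> (\<Sum>n<K. \<Sum>N\<in>M n. norm u ^ n)"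
      proof (intro sum_mono)
        fix n N assume "N \<in> M n"
        thus "norm (?f N) \<le> norm u ^ n" using nf[of N] by (simp add: M_def)
      qed
      also have "\<dots> = (\<Sum>n<K. r ^ n)" by (simp add: cardM r_def power_mult_distrib)
      also have "\<dots> \<le> (\<Sum>n. r ^ n)" using r by (intro sum_le_suminf) auto
      finally show "(\<Sum>N\<in>F. norm (?f N)) \<le> (\<Sum>n. r ^ n)" .
    qed
  qed auto
  hence "?f summable_on {N. lead_coeff N = 1}" by (rule abs_summable_summable)
  then obtain S where S: "(?f has_sum S) {N. lead_coeff N = 1}" by (auto simp: summable_on_def)
  have bij: "bij_betw snd (Sigma UNIV M) {N. lead_coeff N = 1}"
    by (rule bij_betw_byWitness[where f' = "\<lambda>N. (degree N, N)"]) (auto simp: M_def)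
  have "((\<lambda>x. ?f (snd x)) has_sum S) (Sigma UNIV M)"
    using S has_sum_reindex_bij_betw[OF bij, of ?f S] by simp
  hence "((\<lambda>n. \<Sum>N\<in>M n. ?f N) has_sum S) UNIV"
    by (rule has_sum_SigmaD) (use finM in \<open>auto intro!: has_sum_finite\<close>)
  moreover have eq: "(\<Sum>N\<in>M n. ?f N) = u ^ n * (\<Sum>N\<in>M n. \<psi> N)" for n
    unfolding dirichlet_L_summand_def poly_norm_powr u_def[symmetric] sum_distrib_left
    by (rule sum.cong) (auto simp: M_def)
  ultimately have 1: "((\<lambda>n. u ^ n * (\<Sum>N\<in>M n. \<psi> N)) has_sum S) UNIV" by simp
  have "((\<lambda>n. u ^ n * (\<Sum>N\<in>M n. \<psi> N)) has_sum S) {..<degree Q}"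
    by (rule has_sum_cong_neutral[THEN iffD1, OF _ _ _ 1])
       (use sum_character_monic[OF assms(1,3,2)] in \<open>auto simp: M_def not_less\<close>)
  hence "S = (\<Sum>n<degree Q. u ^ n * (\<Sum>N\<in>M n. \<psi> N))"
    using has_sum_finite[of "{..<degree Q}"] has_sum_unique by blast
  thus ?thesis using S by (simp add: u_def M_def)
qed

lemma dirichlet_L_eq:
  fixes Q :: "'a :: {field, finite} poly"
  assumes "\<psi> \<in> dirichlet_characters Q" "\<psi> \<noteq> trivial_character Q" "Q \<noteq> 0"
  shows "dirichlet_L \<psi> s =
           (\<Sum>n<degree Q. (of_nat CARD('a) powr (- s)) ^ n * (\<Sum>N | lead_coeff N = 1 \<and> degree N = n. \<psi> N))"
proof -
  define P where "P = (\<Sum>n<degree Q. monom (\<Sum>N | lead_coeff N = 1 \<and> degree N = n. \<psi> N) n)"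
  have poly_P: "poly P z = (\<Sum>n<degree Q. z ^ n * (\<Sum>N | lead_coeff N = 1 \<and> degree N = n. \<psi> N))" for z
    by (simp add: P_def poly_sum poly_monom mult.commute)
  have sums: "(dirichlet_L_summand \<psi> z has_sum poly P (of_nat CARD('a) powr (- z))) {N. lead_coeff N = 1}"
    if "Re z > 1" for z
    unfolding poly_P by (rule dirichlet_L_summand_has_sum[OF assms that])
  have "(THE P. \<forall>z. Re z > 1 \<longrightarrow>
          (dirichlet_L_summand \<psi> z has_sum poly P (of_nat CARD('a) powr (- z))) {N. lead_coeff N = 1}) = P"
  proof (rule the_equality)
    fix R assume R: "\<forall>z. Re z > 1 \<longrightarrow>
      (dirichlet_L_summand \<psi> z has_sum poly R (of_nat CARD('a) powr (- z))) {N. lead_coeff N = 1}"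
    have "poly (R - P) (of_nat CARD('a) powr (- z)) = 0" if "Re z > 1" for z
      using has_sum_unique[OF R[rule_format, OF that] sums[OF that]] by simp
    from this[of "of_nat (k + 2)" for k] have sub: "range (\<lambda>k :: nat. of_nat CARD('a) powr (- of_nat (k + 2)) :: complex) \<subseteq> {w. poly (R - P) w = 0}"
      by (auto simp del: of_nat_add poly_diff)
    have "inj (\<lambda>k :: nat. of_nat CARD('a) powr (- of_nat (k + 2)) :: complex)"
    proof (rule injI)
      fix k l :: nat
      assume eq: "(of_nat CARD('a) powr (- of_nat (k + 2)) :: complex) = of_nat CARD('a) powr (- of_nat (l + 2))"
      have "real CARD('a) powr (- real (k + 2)) = real CARD('a) powr (- real (l + 2))"
        using arg_cong[OF eq, of norm] unfolding norm_q_powr by simp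
      thus "k = l" using card_field_ge_2[where 'a = 'a] powr_inj[of "real CARD('a)"] by simp
    qed
    hence "infinite (range (\<lambda>k :: nat. of_nat CARD('a) powr (- of_nat (k + 2)) :: complex))"
      by (rule range_inj_infinite)
    hence "infinite {w. poly (R - P) w = 0}" using sub finite_subset by blast
    thus "R = P" using poly_roots_finite[of "R - P"] by auto
  qed (use sums in blast)
  thus ?thesis
    using infsumI[OF sums, of s] by (simp add: dirichlet_L_def flip: poly_P)
qed

end

theory Submission
  imports "HOL-Algebra.Multiplicative_Group" Defs
begin

text \<open>For nontrivial \<open>\<psi>\<close> the value \<open>L(1/2, \<psi>)\<close> is the sum of \<open>|N| powr (-1/2) * \<psi> N\<close> over the
  monic \<open>N\<close> with \<open>degree N < degree Q\<close>. These \<open>N\<close> are coprime to \<open>Q\<close> and pairwise incongruent, so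
  orthogonality leaves only the diagonal when this sum is squared and summed over all \<open>\<psi>\<close>, which
  gives \<open>\<phi>(Q)\<close> times the sum of \<open>1 / |N|\<close>, that is \<open>\<phi>(Q) * degree Q\<close>. The trivial character
  contributes \<open>((sqrt q ^ degree Q - 1) / (sqrt q - 1))^2 = O(\<phi>(Q))\<close>. Orthogonality needs one
  character that separates residues from 1, and the cyclic group of units modulo \<open>Q\<close> has
  one: send a generator to a primitive root of unity.\<close>

section \<open>Arithmetic modulo an irreducible polynomial\<close>

lemma irreducible_coprime_iff:
  fixes Q :: "'a :: field poly"
  assumes "irreducible Q"
  shows "coprime A Q \<longleftrightarrow> \<not> Q dvd A"
proof
  assume c: "coprime A Q"
  show "\<not> Q dvd A"
  proof
    assume "Q dvd A"
    hence "is_unit Q" using coprime_common_divisor[OF c, of Q] by simp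
    thus False using assms by (simp add: irreducible_def)
  qed
next
  assume nd: "\<not> Q dvd A"
  show "coprime A Q"
  proof (rule coprimeI)
    fix C assume C: "C dvd A" "C dvd Q"
    have "Q dvd C \<or> is_unit C" using irreducibleD'[OF assms C(2)] .
    thus "is_unit C" using nd C(1) dvd_trans by blast
  qed
qed

text \<open>Euclid's lemma: if \<open>Q\<close> does not divide \<open>A\<close>, it is coprime to
  \<open>A\<close>, and a Bezout relation cancels \<open>A\<close>.\<close>

lemma irreducible_dvd_mult_iff:
  fixes Q :: "'a :: field poly"
  assumes "irreducible Q"
  shows "Q dvd A * B \<longleftrightarrow> Q dvd A \<or> Q dvd B"
proof
  show "Q dvd A \<or> Q dvd B" if "Q dvd A * B"
    using coprime_dvd_mult_poly[OF _ that] irreducible_coprime_iff[OF assms, of A] by blast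
qed auto

lemma inverse_mod_irreducible:
  fixes Q :: "'a :: field poly"
  assumes "irreducible Q" "\<not> Q dvd A"
  shows "\<exists>B. (A * B) mod Q = 1 mod Q"
proof -
  have "coprime A Q" using irreducible_coprime_iff[OF assms(1)] assms(2) by blast
  then obtain U V where UV: "U * A + V * Q = 1" using coprime_bezout_poly by blast
  have "(A * U) mod Q = (U * A + V * Q) mod Q" by (simp add: mult.commute)
  thus ?thesis unfolding UV by blast
qed

lemma irreducible_degree_pos:
  fixes Q :: "'a :: field poly"
  assumes "irreducible Q"
  shows "degree Q > 0"
proof (rule ccontr)
  assume "\<not> degree Q > 0"
  moreover have "Q \<noteq> 0" using assms by auto
  ultimately have "is_unit Q" using is_unit_iff_degree[of Q] by blast
  thus False using assms by (simp add: irreducible_def)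
qed

section \<open>The residue field and its primitive roots\<close>

text \<open>Classes are represented by remainders, in a structure to which the cyclicity of the
  multiplicative group of a finite field applies. Writing the unit as \<open>1 mod Q\<close> keeps
  the ring laws valid for constant \<open>Q\<close> as well.\<close>

definition poly_residue_ring :: "'a :: field poly \<Rightarrow> 'a poly ring" where
  "poly_residue_ring Q = \<lparr>carrier = range (\<lambda>A. A mod Q), monoid.mult = \<lambda>A B. (A * B) mod Q,
     one = 1 mod Q, zero = 0, add = \<lambda>A B. (A + B) mod Q\<rparr>"

lemma poly_residue_ring_simps:
  "carrier (poly_residue_ring Q) = range (\<lambda>A. A mod Q)"
  "A \<otimes>\<^bsub>poly_residue_ring Q\<^esub> B = (A * B) mod Q"
  "A \<oplus>\<^bsub>poly_residue_ring Q\<^esub> B = (A + B) mod Q"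
  "\<one>\<^bsub>poly_residue_ring Q\<^esub> = 1 mod Q" "\<zero>\<^bsub>poly_residue_ring Q\<^esub> = 0"
  by (simp_all add: poly_residue_ring_def)

lemma residue_not_dvd:
  fixes Q :: "'a :: field poly"
  assumes "A \<in> range (\<lambda>A. A mod Q)" "A \<noteq> 0"
  shows "\<not> Q dvd A"
proof
  assume "Q dvd A"
  hence "A mod Q = 0" by (rule dvd_imp_mod_0)
  moreover have "A mod Q = A" using assms(1) by (elim imageE) (simp only: mod_mod_trivial)
  ultimately show False using assms(2) by metis
qed

lemma abelian_group_poly_residue_ring: "abelian_group (poly_residue_ring Q)"
proof (rule abelian_groupI)
  let ?R = "poly_residue_ring Q"
  show "\<zero>\<^bsub>?R\<^esub> \<in> carrier ?R"
    unfolding poly_residue_ring_simps by (rule range_eqI[of _ _ 0]) simp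
  fix x y z assume x: "x \<in> carrier ?R"
  show "x \<oplus>\<^bsub>?R\<^esub> y \<in> carrier ?R" unfolding poly_residue_ring_simps by (rule rangeI)
  show "(x \<oplus>\<^bsub>?R\<^esub> y) \<oplus>\<^bsub>?R\<^esub> z = x \<oplus>\<^bsub>?R\<^esub> (y \<oplus>\<^bsub>?R\<^esub> z)"
    by (simp only: poly_residue_ring_simps mod_add_left_eq mod_add_right_eq add.assoc)
  show "x \<oplus>\<^bsub>?R\<^esub> y = y \<oplus>\<^bsub>?R\<^esub> x" by (simp only: poly_residue_ring_simps add.commute)
  show "\<zero>\<^bsub>?R\<^esub> \<oplus>\<^bsub>?R\<^esub> x = x"
    using x unfolding poly_residue_ring_simps by (elim imageE) (simp only: add_0_left mod_mod_trivial)
  have "(- x) mod Q \<in> carrier ?R" unfolding poly_residue_ring_simps by (rule rangeI)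
  moreover have "(- x) mod Q \<oplus>\<^bsub>?R\<^esub> x = \<zero>\<^bsub>?R\<^esub>"
    by (simp only: poly_residue_ring_simps mod_add_left_eq add.left_inverse mod_0)
  ultimately show "\<exists>y\<in>carrier ?R. y \<oplus>\<^bsub>?R\<^esub> x = \<zero>\<^bsub>?R\<^esub>" by (rule bexI[rotated])
qed

lemma cring_poly_residue_ring: "cring (poly_residue_ring Q)"
proof (rule cringI[OF abelian_group_poly_residue_ring])
  let ?R = "poly_residue_ring Q"
  show "comm_monoid ?R"
  proof (rule comm_monoidI)
    show "\<one>\<^bsub>?R\<^esub> \<in> carrier ?R" unfolding poly_residue_ring_simps by (rule rangeI)
    fix x y z assume x: "x \<in> carrier ?R"
    show "x \<otimes>\<^bsub>?R\<^esub> y \<in> carrier ?R" unfolding poly_residue_ring_simps by (rule rangeI)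
    show "(x \<otimes>\<^bsub>?R\<^esub> y) \<otimes>\<^bsub>?R\<^esub> z = x \<otimes>\<^bsub>?R\<^esub> (y \<otimes>\<^bsub>?R\<^esub> z)"
      by (simp only: poly_residue_ring_simps mod_mult_left_eq mod_mult_right_eq mult.assoc)
    show "x \<otimes>\<^bsub>?R\<^esub> y = y \<otimes>\<^bsub>?R\<^esub> x" by (simp only: poly_residue_ring_simps mult.commute)
    show "\<one>\<^bsub>?R\<^esub> \<otimes>\<^bsub>?R\<^esub> x = x"
      using x unfolding poly_residue_ring_simps
      by (elim imageE) (simp only: mod_mult_left_eq mult_1_left mod_mod_trivial)
  qed
  show "(x \<oplus>\<^bsub>?R\<^esub> y) \<otimes>\<^bsub>?R\<^esub> z = x \<otimes>\<^bsub>?R\<^esub> z \<oplus>\<^bsub>?R\<^esub> y \<otimes>\<^bsub>?R\<^esub> z" for x y z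
    by (simp only: poly_residue_ring_simps mod_mult_left_eq mod_add_eq distrib_right)
qed

lemma field_poly_residue_ring:
  fixes Q :: "'a :: field poly"
  assumes "irreducible Q"
  shows "field (poly_residue_ring Q)"
proof (rule cring.cring_fieldI2[OF cring_poly_residue_ring])
  let ?R = "poly_residue_ring Q"
  show "\<zero>\<^bsub>?R\<^esub> \<noteq> \<one>\<^bsub>?R\<^esub>"
    using irreducible_degree_pos[OF assms] by (simp add: poly_residue_ring_simps mod_poly_less)
  fix A assume "A \<in> carrier ?R" "A \<noteq> \<zero>\<^bsub>?R\<^esub>"
  hence "\<not> Q dvd A" unfolding poly_residue_ring_simps by (rule residue_not_dvd)
  then obtain B where "(A * B) mod Q = 1 mod Q" using inverse_mod_irreducible[OF assms] by blast
  hence "A \<otimes>\<^bsub>?R\<^esub> (B mod Q) = \<one>\<^bsub>?R\<^esub>"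
    by (simp only: poly_residue_ring_simps mod_mult_right_eq)
  moreover have "B mod Q \<in> carrier ?R" unfolding poly_residue_ring_simps by (rule rangeI)
  ultimately show "\<exists>B\<in>carrier ?R. A \<otimes>\<^bsub>?R\<^esub> B = \<one>\<^bsub>?R\<^esub>" by (rule bexI)
qed

text \<open>The nonzero residues form the multiplicative group of a finite field, which is cyclic:
  \<open>g\<close> is a generator and \<open>n\<close> its order.\<close>

lemma primitive_root_poly:
  fixes Q :: "'a :: {field, finite} poly"
  assumes "irreducible Q"
  obtains g n where "n > 0" "\<And>A. \<not> Q dvd A \<Longrightarrow> \<exists>i :: nat. A mod Q = g ^ i mod Q"
    "\<And>i j. g ^ i mod Q = g ^ j mod Q \<longleftrightarrow> [i = j] (mod n)"
proof -
  let ?R = "poly_residue_ring Q"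
  interpret R: field ?R by (rule field_poly_residue_ring[OF assms])
  interpret M: group "mult_of ?R" by (rule R.field_mult_group)
  have Q0: "Q \<noteq> 0" using assms by auto
  have fin: "finite (carrier ?R)"
    using finite_range_mod_poly[OF Q0] by (simp add: poly_residue_ring_simps)
  obtain g where g: "g \<in> carrier (mult_of ?R)"
    and gen: "carrier (mult_of ?R) = {g [^]\<^bsub>?R\<^esub> i | i :: nat. i \<in> UNIV}"
    using R.finite_field_mult_group_has_gen[OF fin] by blast
  have pow: "g [^]\<^bsub>?R\<^esub> i = g ^ i mod Q" for i :: nat
    by (induction i) (simp_all add: poly_residue_ring_simps mod_mult_right_eq mult.commute)
  have pow': "g [^]\<^bsub>mult_of ?R\<^esub> i = g ^ i mod Q" for i :: nat
    using pow by (simp add: nat_pow_mult_of)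
  show ?thesis
  proof
    have finM: "finite (carrier (mult_of ?R))" using fin by simp
    show "M.ord g > 0" using M.ord_ge_1[OF finM g] by simp
    show "\<exists>i :: nat. A mod Q = g ^ i mod Q" if "\<not> Q dvd A" for A
    proof -
      have "A mod Q \<in> carrier (mult_of ?R)"
        using that by (simp add: poly_residue_ring_simps mod_eq_0_iff_dvd)
      thus ?thesis unfolding gen pow by auto
    qed
    show "g ^ i mod Q = g ^ j mod Q \<longleftrightarrow> [i = j] (mod M.ord g)" for i j
    proof -
      \<comment> \<open>Integer exponents give divisibility of a signed difference, so it does not
        matter which exponent is larger.\<close>
      have "g ^ i mod Q = g ^ j mod Q \<longleftrightarrow> int (M.ord g) dvd int j - int i"
        using M.int_pow_eq[OF g, of "int i" "int j"] by (simp add: int_pow_int pow')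
      also have "\<dots> \<longleftrightarrow> [int j = int i] (mod int (M.ord g))"
        by (simp add: cong_iff_dvd_diff)
      finally show ?thesis by (simp add: cong_int_iff cong_sym_eq)
    qed
  qed
qed

section \<open>A character with trivial kernel\<close>

text \<open>Angles of the same point differ by a multiple of \<open>2 * pi\<close>; cancelling
  \<open>2 * pi / n\<close> leaves a congruence of exponents, the same one that governs the powers
  of a primitive root of order \<open>n\<close>.\<close>

lemma cis_root_eq_iff:
  assumes "n > 0"
  shows "cis (2 * pi * real i / real n) = cis (2 * pi * real j / real n) \<longleftrightarrow> [i = j] (mod n)"
proof -
  have "cis (2 * pi * real i / real n) = cis (2 * pi * real j / real n) \<longleftrightarrow>
          (\<exists>m :: int. 2 * pi * real i / real n = 2 * pi * real j / real n + 2 * real_of_int m * pi)"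
    unfolding cis_conv_exp complex_eq_iff[symmetric] exp_eq
    by (auto simp: complex_eq_iff)
  also have "\<dots> \<longleftrightarrow> (\<exists>m :: int. real_of_int (int i) = real_of_int (int j + int n * m))"
  proof (rule arg_cong[where f = Ex], rule ext)
    fix m :: int
    have "2 * pi * real i / real n = 2 * pi * real j / real n + 2 * real_of_int m * pi \<longleftrightarrow>
            (2 * pi) * real i = (2 * pi) * (real j + real n * m)"
      using assms by (simp add: field_simps)
    thus "2 * pi * real i / real n = 2 * pi * real j / real n + 2 * real_of_int m * pi \<longleftrightarrow>
            real_of_int (int i) = real_of_int (int j + int n * m)"
      by simp
  qed
  also have "\<dots> \<longleftrightarrow> [int j = int i] (mod int n)"
    unfolding of_int_eq_iff cong_iff_lin by blast
  finally show ?thesis by (simp add: cong_int_iff cong_sym_eq)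
qed

text \<open>Powers of a primitive root and powers of \<open>cis (2 * pi / n)\<close> coincide under
  the same congruence of exponents modulo \<open>n\<close>. Matching them is therefore well defined
  and injective on units.\<close>

lemma faithful_character_exists:
  fixes Q :: "'a :: {field, finite} poly"
  assumes irr: "irreducible Q"
  obtains \<psi> where "\<psi> \<in> dirichlet_characters Q" "\<And>A. \<psi> A = 1 \<Longrightarrow> A mod Q = 1 mod Q"
proof -
  obtain g n where n: "n > 0" and gen: "\<And>A. \<not> Q dvd A \<Longrightarrow> \<exists>i :: nat. A mod Q = g ^ i mod Q"
    and pow: "\<And>i j. g ^ i mod Q = g ^ j mod Q \<longleftrightarrow> [i = j] (mod n)"
    using primitive_root_poly[OF irr] by metis
  \<comment> \<open>\<open>ind\<close> is a discrete logarithm to the base \<open>g\<close>, chosen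
    separately for each polynomial. It is determined only modulo \<open>n\<close>, which suffices
    because \<open>e\<close> below has period \<open>n\<close>.\<close>
  obtain ind :: "'a poly \<Rightarrow> nat" where ind: "\<And>A. \<not> Q dvd A \<Longrightarrow> A mod Q = g ^ ind A mod Q"
    using gen by metis
  define e where "e = (\<lambda>i :: nat. cis (2 * pi * real i / real n))"
  have e_cong: "e i = e j" if "[i = j] (mod n)" for i j
    unfolding e_def using cis_root_eq_iff[OF n] that by blast
  have e_add: "e (i + j) = e i * e j" for i j
    by (simp add: e_def cis_mult ring_distribs add_divide_distrib)
  define \<psi> where "\<psi> = (\<lambda>A. if Q dvd A then 0 else e (ind A))"
  note prime = irreducible_dvd_mult_iff[OF irr]
  show ?thesis
  proof
    have "\<psi> (A + B * Q) = \<psi> A" for A B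
    proof (cases "Q dvd A")
      case False
      hence F: "\<not> Q dvd A + B * Q" by (simp add: dvd_add_left_iff)
      have "g ^ ind (A + B * Q) mod Q = g ^ ind A mod Q"
        using ind[OF False] ind[OF F] by simp
      thus ?thesis using False F pow e_cong by (simp add: \<psi>_def)
    qed (auto simp: \<psi>_def)
    moreover have "\<psi> (A * B) = \<psi> A * \<psi> B" for A B
    proof (cases "Q dvd A * B")
      case False
      hence F: "\<not> Q dvd A" "\<not> Q dvd B" using prime by auto
      have "g ^ ind (A * B) mod Q = (g ^ ind A mod Q * (g ^ ind B mod Q)) mod Q"
        using ind[OF False] ind[OF F(1)] ind[OF F(2)] by (metis mod_mult_eq)
      hence "[ind (A * B) = ind A + ind B] (mod n)" by (simp add: mod_mult_eq pow flip: power_add)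
      thus ?thesis using False F e_cong e_add by (simp add: \<psi>_def)
    qed (use prime in \<open>auto simp: \<psi>_def\<close>)
    ultimately show "\<psi> \<in> dirichlet_characters Q"
      by (auto simp: dirichlet_characters_def irreducible_coprime_iff[OF irr] \<psi>_def e_def)
    show "A mod Q = 1 mod Q" if "\<psi> A = 1" for A
    proof -
      \<comment> \<open>Multiples of \<open>Q\<close> are excluded because \<open>\<psi>\<close> is
        0 there.\<close>
      have nd: "\<not> Q dvd A" and "e (ind A) = 1" using that by (auto simp: \<psi>_def split: if_splits)
      hence "[ind A = 0] (mod n)" using cis_root_eq_iff[OF n, of "ind A" 0] by (simp add: e_def)
      thus ?thesis using ind[OF nd] pow[of "ind A" 0] by simp
    qed
  qed
qed

section \<open>Sums over all characters\<close>

lemma characters_mult_closed: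
  assumes "\<psi> \<in> dirichlet_characters Q" "\<eta> \<in> dirichlet_characters Q"
  shows "(\<lambda>A. \<psi> A * \<eta> A) \<in> dirichlet_characters Q"
  using assms by (auto simp: dirichlet_characters_def)

text \<open>Multiplication by a character \<open>\<eta>\<close> with
  \<open>\<eta> A \<noteq> 1\<close> permutes the characters, so the sum equals
  \<open>\<eta> A\<close> times itself.\<close>

lemma sum_over_characters_eq_0:
  fixes Q :: "'a :: {field, finite} poly"
  assumes irr: "irreducible Q" and "A mod Q \<noteq> 1 mod Q"
  shows "(\<Sum>\<psi>\<in>dirichlet_characters Q. \<psi> A) = 0"
proof (cases "Q dvd A")
  case True
  hence "\<psi> A = 0" if "\<psi> \<in> dirichlet_characters Q" for \<psi>
    using that irreducible_coprime_iff[OF irr] by (auto simp: dirichlet_characters_def)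
  thus ?thesis by (rule sum.neutral[rule_format])
next
  case False
  let ?X = "dirichlet_characters Q"
  have Q0: "Q \<noteq> 0" using irr by auto
  obtain \<eta> where \<eta>: "\<eta> \<in> ?X" "\<eta> A \<noteq> 1" using faithful_character_exists[OF irr] assms(2) by metis
  define T where "T = (\<lambda>(\<psi> :: 'a poly \<Rightarrow> complex) B. \<eta> B * \<psi> B)"
  have inj: "inj_on T ?X"
  proof (intro inj_onI ext)
    fix \<psi> \<theta> B assume *: "\<psi> \<in> ?X" "\<theta> \<in> ?X" "T \<psi> = T \<theta>"
    show "\<psi> B = \<theta> B"
    \<comment> \<open>On units the nonzero factor \<open>\<eta> B\<close> cancels; elsewhere both
      characters vanish.\<close>
    proof (cases "coprime B Q")
      case True
      thus ?thesis using fun_cong[OF *(3), of B] character_nz_iff[OF \<eta>(1) Q0, of B]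
        by (simp add: T_def)
    next
      case False
      thus ?thesis using character_nz_iff[OF *(1) Q0, of B] character_nz_iff[OF *(2) Q0, of B] by simp
    qed
  qed
  have img: "T ` ?X = ?X"
    by (rule card_subset_eq)
      (use finite_dirichlet_characters[OF Q0] inj characters_mult_closed[OF \<eta>(1)]
        in \<open>auto simp: card_image T_def\<close>)
  have "(\<Sum>\<psi>\<in>?X. \<psi> A) = (\<Sum>\<psi>\<in>?X. T \<psi> A)"
    using sum.reindex[OF inj, of "\<lambda>\<psi>. \<psi> A"] by (simp only: img o_def)
  also have "\<dots> = \<eta> A * (\<Sum>\<psi>\<in>?X. \<psi> A)" by (simp add: T_def sum_distrib_left)
  finally show ?thesis using \<eta>(2) by simp
qed

lemma trivial_character_in:
  fixes Q :: "'a :: {field, finite} poly"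
  assumes irr: "irreducible Q"
  shows "trivial_character Q \<in> dirichlet_characters Q"
proof -
  note prime = irreducible_dvd_mult_iff[OF irr]
  have "Q dvd A + B * Q \<longleftrightarrow> Q dvd A" for A B by (simp add: dvd_add_left_iff)
  thus ?thesis
    by (auto simp: dirichlet_characters_def trivial_character_def irreducible_coprime_iff[OF irr] prime)
qed

section \<open>The number of characters and the value of phi\<close>

lemma card_nonzero_residues:
  assumes "Q \<noteq> (0 :: 'a :: {field, finite} poly)"
  shows "card (range (\<lambda>A. A mod Q) - {0}) = CARD('a) ^ degree Q - 1"
proof -
  have "0 \<in> range (\<lambda>A. A mod Q)" by (metis mod_0 rangeI)
  thus ?thesis
    using degree_less_finite_card[where 'a = 'a, of "degree Q"]
    by (simp add: range_mod_poly[OF assms])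
qed

text \<open>Sum \<open>\<psi> R\<close> over all characters and all residues in both orders. Summing
  over characters first, only the residue of 1 survives and gives the number of characters; summing
  over residues first, only the trivial character survives and gives the number of nonzero
  residues.\<close>

lemma card_dirichlet_characters:
  fixes Q :: "'a :: {field, finite} poly"
  assumes irr: "irreducible Q"
  shows "card (dirichlet_characters Q) = CARD('a) ^ degree Q - 1"
proof -
  let ?X = "dirichlet_characters Q" and ?F = "range (\<lambda>A. A mod Q)"
  have Q0: "Q \<noteq> 0" using irr by auto
  note finF = finite_range_mod_poly[OF Q0] and finX = finite_dirichlet_characters[OF Q0]
  have res: "A mod Q = A" if "A \<in> ?F" for A using that by auto
  have "of_nat (card ?X) = (\<Sum>\<psi>\<in>?X. 1 :: complex)" by simp
  also have "\<dots> = (\<Sum>\<psi>\<in>?X. \<psi> (1 mod Q))"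
    by (intro sum.cong refl) (simp add: character_one[OF _ Q0] character_mod[OF _ Q0])
  also have "\<dots> = (\<Sum>R\<in>{1 mod Q}. \<Sum>\<psi>\<in>?X. \<psi> R)" by simp
  also have "\<dots> = (\<Sum>R\<in>?F. \<Sum>\<psi>\<in>?X. \<psi> R)"
  proof (rule sum.mono_neutral_left[OF finF])
    show "\<forall>R\<in>?F - {1 mod Q}. (\<Sum>\<psi>\<in>?X. \<psi> R) = 0"
      using sum_over_characters_eq_0[OF irr] res by (metis DiffD1 DiffD2 singletonI)
  qed simp
  also have "\<dots> = (\<Sum>\<psi>\<in>?X. \<Sum>R\<in>?F. \<psi> R)" by (rule sum.swap)
  also have "\<dots> = (\<Sum>\<psi>\<in>{trivial_character Q}. \<Sum>R\<in>?F. \<psi> R)"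
  proof (rule sum.mono_neutral_right[OF finX])
    show "\<forall>\<psi>\<in>?X - {trivial_character Q}. (\<Sum>R\<in>?F. \<psi> R) = 0"
      using sum_character_residues[OF _ Q0] by (metis DiffD1 DiffD2 singletonI)
  qed (simp add: trivial_character_in[OF irr])
  also have "\<dots> = (\<Sum>R\<in>?F. trivial_character Q R)" by simp
  also have "\<dots> = (\<Sum>R\<in>?F - {0}. 1)"
  proof (rule sum.mono_neutral_cong_right)
    show "trivial_character Q R = 1" if "R \<in> ?F - {0}" for R
    proof -
      have "\<not> Q dvd R" using that res[of R] by (auto simp: dvd_eq_mod_eq_0)
      thus ?thesis by (simp add: trivial_character_def irreducible_coprime_iff[OF irr])
    qed
  qed (use finF in \<open>auto simp: trivial_character_def irreducible_coprime_iff[OF irr]\<close>)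
  also have "\<dots> = of_nat (CARD('a) ^ degree Q - 1)"
    using card_nonzero_residues[OF Q0] by simp
  finally show ?thesis by (simp only: of_nat_eq_iff)
qed

lemma poly_phi_irreducible:
  fixes Q :: "'a :: {field, finite} poly"
  assumes irr: "irreducible Q"
  shows "poly_phi Q = CARD('a) ^ degree Q - 1"
proof -
  let ?F = "range (\<lambda>A. A mod Q)"
  let ?r = "{(A, B). [A = B] (mod Q)}"
  let ?U = "{C \<in> UNIV // ?r. \<exists>A\<in>C. \<exists>B. [A * B = 1] (mod Q)}"
  have Q0: "Q \<noteq> 0" using irr by auto
  have cls: "?r `` {A} = {B. A mod Q = B mod Q}" for A by (auto simp: cong_def)
  have inv: "(\<exists>B. [A * B = 1] (mod Q)) \<longleftrightarrow> \<not> Q dvd A" for A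
  proof
    assume "\<exists>B. [A * B = 1] (mod Q)"
    then obtain B where "(A * B) mod Q = 1 mod Q" by (auto simp: cong_def)
    moreover have "1 mod Q = 1" using irreducible_degree_pos[OF irr] by (simp add: mod_poly_less)
    ultimately show "\<not> Q dvd A" by (metis dvd_eq_mod_eq_0 dvd_mult2 zero_neq_one)
  qed (use inverse_mod_irreducible[OF irr] in \<open>auto simp: cong_def\<close>)
  have "bij_betw (\<lambda>R. ?r `` {R}) (?F - {0}) ?U"
  proof (rule bij_betw_imageI)
    show "inj_on (\<lambda>R. ?r `` {R}) (?F - {0})"
    proof (rule inj_onI)
      fix R S assume *: "R \<in> ?F - {0}" "S \<in> ?F - {0}" "?r `` {R} = ?r `` {S}"
      have "R mod Q = S mod Q" using *(3) unfolding cls by blast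
      thus "R = S" using *(1,2) by auto
    qed
    show "(\<lambda>R. ?r `` {R}) ` (?F - {0}) = ?U"
    proof (intro equalityI subsetI)
      fix C assume "C \<in> (\<lambda>R. ?r `` {R}) ` (?F - {0})"
      then obtain R where R: "R \<in> ?F" "R \<noteq> 0" "C = ?r `` {R}" by auto
      hence "\<not> Q dvd R" by (auto simp: dvd_eq_mod_eq_0)
      moreover have "R \<in> C" using R by simp
      moreover have "C \<in> UNIV // ?r" unfolding R(3) by (rule quotientI) simp
      ultimately show "C \<in> ?U" using inv by blast
    next
      \<comment> \<open>The invertible member \<open>A'\<close> may differ from the representative
        \<open>A\<close> of the class, but both have the same remainder.\<close>
      fix C assume "C \<in> ?U"
      then obtain A A' where A: "C = ?r `` {A}" "A' \<in> C" "\<not> Q dvd A'"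
        using inv by (auto elim!: quotientE)
      hence "A mod Q = A' mod Q" unfolding cls by simp
      hence "A mod Q \<noteq> 0" using A(3) by (simp add: dvd_eq_mod_eq_0)
      moreover have "C = ?r `` {A mod Q}" unfolding A(1) cls by simp
      ultimately show "C \<in> (\<lambda>R. ?r `` {R}) ` (?F - {0})" by blast
    qed
  qed
  from bij_betw_same_card[OF this] show ?thesis
    unfolding poly_phi_def card_nonzero_residues[OF Q0] by (rule sym)
qed

section \<open>Orthogonality and mean squares\<close>

lemma norm_character_eq_1:
  fixes Q :: "'a :: {field, finite} poly"
  assumes irr: "irreducible Q" and X: "\<psi> \<in> dirichlet_characters Q" and "\<not> Q dvd A"
  shows "norm (\<psi> A) = 1"
proof -
  have Q0: "Q \<noteq> 0" using irr by auto
  have "\<psi> A ^ fact (card (range (\<lambda>A :: 'a poly. A mod Q))) = 1"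
    using character_root_of_unity[OF X Q0, of A] assms(3) irreducible_coprime_iff[OF irr] by simp
  thus ?thesis using power_eq_1_iff fact_nonzero by metis
qed

text \<open>On units the values of \<open>\<psi>\<close> have modulus 1, so
  \<open>cnj (\<psi> N)\<close> is the value at an inverse \<open>B\<close> of \<open>N\<close>. The
  summand becomes \<open>\<psi> (M * B)\<close>, and \<open>M * B\<close> is congruent to 1 exactly
  when \<open>M\<close> is congruent to \<open>N\<close>.\<close>

lemma character_orthogonality:
  fixes Q :: "'a :: {field, finite} poly"
  assumes irr: "irreducible Q" and M: "\<not> Q dvd M" and N: "\<not> Q dvd N"
  shows "(\<Sum>\<psi>\<in>dirichlet_characters Q. \<psi> M * cnj (\<psi> N)) =
           (if M mod Q = N mod Q then of_nat (CARD('a) ^ degree Q - 1) else 0)"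
proof -
  let ?X = "dirichlet_characters Q"
  have Q0: "Q \<noteq> 0" using irr by auto
  obtain B where B: "(N * B) mod Q = 1 mod Q" using inverse_mod_irreducible[OF irr N] by blast
  have cnj: "cnj (\<psi> N) = \<psi> B" if "\<psi> \<in> ?X" for \<psi>
  proof -
    have "\<psi> N * \<psi> B = \<psi> (1 mod Q)"
      using character_mult[OF that Q0, of N B] character_mod[OF that Q0] B by metis
    hence 1: "\<psi> N * \<psi> B = 1" using character_mod[OF that Q0] character_one[OF that Q0] by simp
    moreover have "\<psi> N * cnj (\<psi> N) = 1"
      using norm_character_eq_1[OF irr that N] by (simp add: complex_norm_square[symmetric])
    ultimately show ?thesis by (metis mult_left_cancel mult_zero_left zero_neq_one)
  qed
  have eq: "(\<Sum>\<psi>\<in>?X. \<psi> M * cnj (\<psi> N)) = (\<Sum>\<psi>\<in>?X. \<psi> (M * B))"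
    using cnj character_mult[OF _ Q0] by simp
  show ?thesis
  proof (cases "M mod Q = N mod Q")
    case True
    hence "(M * B) mod Q = 1 mod Q" using B by (metis mod_mult_left_eq)
    hence "\<psi> (M * B) = 1" if "\<psi> \<in> ?X" for \<psi>
      using character_mod[OF that Q0] character_one[OF that Q0] by metis
    hence "(\<Sum>\<psi>\<in>?X. \<psi> (M * B)) = (\<Sum>\<psi>\<in>?X. 1)" by (rule sum.cong[OF refl])
    thus ?thesis using True eq card_dirichlet_characters[OF irr] by simp
  next
    case False
    have "(M * B) mod Q \<noteq> 1 mod Q"
    proof
      assume "(M * B) mod Q = 1 mod Q"
      hence "(M * B * N) mod Q = N mod Q" by (metis mod_mult_left_eq mult_1)
      moreover have "(M * (N * B)) mod Q = M mod Q" using B by (metis mod_mult_right_eq mult_1_right)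
      ultimately show False using False by (simp add: ac_simps)
    qed
    thus ?thesis using False eq sum_over_characters_eq_0[OF irr] by simp
  qed
qed

text \<open>Expand the square and sum over characters first. Polynomials of degree below
  \<open>degree Q\<close> are their own remainders, so congruence is equality and only the diagonal
  remains.\<close>

lemma sum_norm_square_characters:
  fixes Q :: "'a :: {field, finite} poly" and c :: "'a poly \<Rightarrow> real"
  assumes irr: "irreducible Q" and fin: "finite S"
    and S: "\<And>N. N \<in> S \<Longrightarrow> N \<noteq> 0 \<and> degree N < degree Q"
  shows "(\<Sum>\<psi>\<in>dirichlet_characters Q. (norm (\<Sum>N\<in>S. c N * \<psi> N))\<^sup>2) =
           real (CARD('a) ^ degree Q - 1) * (\<Sum>N\<in>S. (c N)\<^sup>2)"
proof -
  let ?X = "dirichlet_characters Q"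
  let ?n = "CARD('a) ^ degree Q - 1"
  have nd: "\<not> Q dvd N" and modS: "N mod Q = N" if "N \<in> S" for N
    using S[OF that] by (auto simp: mod_poly_less dest: dvd_imp_degree_le)
  have "complex_of_real (\<Sum>\<psi>\<in>?X. (norm (\<Sum>N\<in>S. c N * \<psi> N))\<^sup>2) =
          (\<Sum>\<psi>\<in>?X. \<Sum>M\<in>S. \<Sum>N\<in>S. c M * c N * (\<psi> M * cnj (\<psi> N)))"
    unfolding of_real_sum complex_norm_square
    by (simp add: sum_product mult_ac)
  also have "\<dots> = (\<Sum>M\<in>S. \<Sum>\<psi>\<in>?X. \<Sum>N\<in>S. c M * c N * (\<psi> M * cnj (\<psi> N)))"
    by (rule sum.swap)
  also have "\<dots> = (\<Sum>M\<in>S. \<Sum>N\<in>S. \<Sum>\<psi>\<in>?X. c M * c N * (\<psi> M * cnj (\<psi> N)))"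
    by (intro sum.cong[OF refl] sum.swap)
  also have "\<dots> = (\<Sum>M\<in>S. \<Sum>N\<in>S. if M = N then of_nat ?n * complex_of_real (c M) * of_real (c N) else 0)"
  proof (intro sum.cong refl)
    fix M N assume MN: "M \<in> S" "N \<in> S"
    show "(\<Sum>\<psi>\<in>?X. c M * c N * (\<psi> M * cnj (\<psi> N))) =
            (if M = N then of_nat ?n * complex_of_real (c M) * of_real (c N) else 0)"
      using character_orthogonality[OF irr nd[OF MN(1)] nd[OF MN(2)]] modS[OF MN(1)] modS[OF MN(2)]
      by (simp flip: sum_distrib_left)
  qed
  also have "\<dots> = (\<Sum>M\<in>S. of_nat ?n * complex_of_real (c M) * of_real (c M))"
    using fin by (simp add: sum.delta')
  also have "\<dots> = complex_of_real (real ?n * (\<Sum>N\<in>S. (c N)\<^sup>2))"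
    by (simp add: sum_distrib_left power2_eq_square mult_ac)
  finally show ?thesis by (simp only: of_real_eq_iff)
qed

section \<open>The second moment at the central point\<close>

theorem proposition4p2:
  "\<exists>C :: real. \<forall>Q :: 'a :: {field, finite} poly. irreducible Q \<longrightarrow>
     \<bar>1 / real (poly_phi Q) *
        (\<Sum>\<psi>\<in>dirichlet_characters Q - {trivial_character Q}. (norm (dirichlet_L \<psi> (1 / 2)))\<^sup>2)
      - (real (degree Q) - 1)\<bar> \<le> C"
proof -
  define q where "q = real CARD('a)"
  define w where "w = sqrt q"
  have q2: "q \<ge> 2" unfolding q_def using card_field_ge_2[where 'a = 'a] by simp
  have w: "w > 1" "w\<^sup>2 = q" using q2 by (auto simp: w_def)
  \<comment> \<open>The 1 accounts for the shift from \<open>degree Q\<close> to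
    \<open>degree Q - 1\<close>, the fraction for the trivial character.\<close>
  define C where "C = 1 + 2 / (w - 1)\<^sup>2"
  have "\<bar>1 / real (poly_phi Q) *
        (\<Sum>\<psi>\<in>dirichlet_characters Q - {trivial_character Q}. (norm (dirichlet_L \<psi> (1 / 2)))\<^sup>2)
      - (real (degree Q) - 1)\<bar> \<le> C" if irr: "irreducible Q" for Q :: "'a poly"
  proof -
    let ?X = "dirichlet_characters Q"
    define d where "d = degree Q"
    define n where "n = q ^ d - 1"
    have d: "d > 0" using irreducible_degree_pos[OF irr] by (simp add: d_def)
    have Q0: "Q \<noteq> 0" using irr by auto
    have n_eq: "real (CARD('a) ^ degree Q - 1) = n"
      by (simp add: n_def q_def d_def of_nat_diff Suc_le_eq)
    have phi: "real (poly_phi Q) = n" using n_eq by (simp only: poly_phi_irreducible[OF irr])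
    have "q ^ d \<ge> q ^ 1" using q2 d by (intro power_increasing) auto
    hence qd: "q ^ d \<ge> 2" using q2 by simp
    hence n0: "n > 0" by (simp add: n_def)
    define M where "M = (\<lambda>k. {N :: 'a poly. lead_coeff N = 1 \<and> degree N = k})"
    define S where "S = (\<Union>k<d. M k)"
    \<comment> \<open>\<open>c N\<close> is the weight \<open>1 / sqrt |N|\<close>, since
      \<open>w = sqrt q\<close>.\<close>
    define c where "c = (\<lambda>N :: 'a poly. (1 / w) ^ degree N)"
    \<comment> \<open>\<open>L\<close> is the truncated sum for every character. For the trivial one
      it is only an auxiliary quantity, which completes the family so that orthogonality
      applies.\<close>
    define L where "L = (\<lambda>\<psi> :: 'a poly \<Rightarrow> complex. \<Sum>N\<in>S. c N * \<psi> N)"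
    have finM: "finite (M k)" and cardM: "real (card (M k)) = q ^ k" for k
      using monic_degree_finite_card[where 'a = 'a, of k] by (simp_all add: M_def q_def)
    have finS: "finite S" using finM by (simp add: S_def)
    have sumS: "(\<Sum>N\<in>S. f N) = (\<Sum>k<d. \<Sum>N\<in>M k. f N)" for f :: "'a poly \<Rightarrow> 'b :: comm_monoid_add"
      unfolding S_def by (rule sum.UNION_disjoint) (use finM in \<open>auto simp: M_def\<close>)
    have SD: "N \<noteq> 0 \<and> degree N < degree Q" if "N \<in> S" for N
      using that by (auto simp: S_def M_def d_def)
    have u: "of_nat CARD('a) powr (- (1 / 2)) = complex_of_real (1 / w)"
    proof -
      have "of_nat CARD('a) powr (- (1 / 2)) = complex_of_real (q powr (- (1 / 2)))"
        using q2 powr_of_real[of q "- (1 / 2)"] by (simp add: q_def)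
      also have "q powr (- (1 / 2)) = 1 / w"
        using q2 powr_half_sqrt[of q] by (simp only: powr_minus_divide w_def)
      finally show ?thesis .
    qed
    have L_eq: "dirichlet_L \<psi> (1 / 2) = L \<psi>" if "\<psi> \<in> ?X - {trivial_character Q}" for \<psi>
    proof -
      have "dirichlet_L \<psi> (1 / 2) = (\<Sum>k<d. complex_of_real (1 / w) ^ k * (\<Sum>N\<in>M k. \<psi> N))"
        using dirichlet_L_eq[of \<psi> Q "1 / 2"] that Q0 u by (simp add: d_def M_def)
      also have "\<dots> = (\<Sum>k<d. \<Sum>N\<in>M k. c N * \<psi> N)"
        unfolding sum_distrib_left by (intro sum.cong refl) (simp add: M_def c_def)
      finally show ?thesis by (simp add: L_def sumS)
    qed
    have cc: "((1 / w) ^ k)\<^sup>2 = (1 / q) ^ k" for k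
      by (simp add: power_divide power2_eq_square power_mult_distrib flip: w(2))
    have "(\<Sum>N\<in>S. (c N)\<^sup>2) = (\<Sum>k<d. \<Sum>N\<in>M k. (1 / q) ^ k)"
      unfolding sumS by (intro sum.cong refl) (simp add: M_def c_def cc)
    \<comment> \<open>There are \<open>q ^ k\<close> monic polynomials of degree \<open>k\<close>,
      so each degree contributes exactly 1.\<close>
    also have "\<dots> = real d" using q2 by (simp add: cardM power_divide)
    finally have c2: "(\<Sum>N\<in>S. (c N)\<^sup>2) = real d" .
    have full: "(\<Sum>\<psi>\<in>?X. (norm (L \<psi>))\<^sup>2) = n * d"
      using sum_norm_square_characters[OF irr finS SD, of c] unfolding L_def c2 n_eq by simp
    have "L (trivial_character Q) = (\<Sum>N\<in>S. complex_of_real (c N))"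
      unfolding L_def
    proof (intro sum.cong refl)
      fix N assume "N \<in> S"
      hence "\<not> Q dvd N" using SD dvd_imp_degree_le[of Q N] by fastforce
      thus "c N * trivial_character Q N = complex_of_real (c N)"
        by (simp add: trivial_character_def irreducible_coprime_iff[OF irr])
    qed
    also have "\<dots> = complex_of_real (\<Sum>N\<in>S. c N)" by simp
    also have "(\<Sum>N\<in>S. c N) = (\<Sum>k<d. \<Sum>N\<in>M k. (1 / w) ^ k)"
      unfolding sumS by (intro sum.cong refl) (simp add: M_def c_def)
    \<comment> \<open>Here degree \<open>k\<close> contributes
      \<open>q ^ k / w ^ k = w ^ k\<close>.\<close>
    also have "\<dots> = (\<Sum>k<d. w ^ k)"
      using w(1) by (simp add: cardM power_divide flip: w(2)) (simp add: power2_eq_square power_mult_distrib)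
    also have "\<dots> = (w ^ d - 1) / (w - 1)"
      using w(1) by (simp add: geometric_sum)
    finally have triv: "(norm (L (trivial_character Q)))\<^sup>2 = ((w ^ d - 1) / (w - 1))\<^sup>2"
      by (simp only: norm_of_real power2_abs)
    have "(w ^ d - 1)\<^sup>2 \<le> (w ^ d)\<^sup>2"
      using w(1) one_le_power[of w d] by (intro power_mono) auto
    also have "\<dots> = q ^ d" by (simp add: power_mult[symmetric] mult.commute flip: w(2))
    \<comment> \<open>As \<open>q ^ d \<ge> 2\<close>, subtracting 1 at most halves it.\<close>
    also have "\<dots> \<le> 2 * n" using qd by (simp add: n_def)
    finally have "(w ^ d - 1)\<^sup>2 \<le> 2 * n" .
    hence bound: "(norm (L (trivial_character Q)))\<^sup>2 \<le> 2 * n / (w - 1)\<^sup>2"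
      unfolding triv power_divide by (intro divide_right_mono) auto
    \<comment> \<open>\<open>t\<close> is the contribution of the trivial character after division
      by phi.\<close>
    define t where "t = (norm (L (trivial_character Q)))\<^sup>2 / n"
    have t: "0 \<le> t" "t \<le> 2 / (w - 1)\<^sup>2"
      using bound n0 w(1) by (auto simp: t_def field_simps)
    have "(\<Sum>\<psi>\<in>?X - {trivial_character Q}. (norm (dirichlet_L \<psi> (1 / 2)))\<^sup>2) =
            (\<Sum>\<psi>\<in>?X - {trivial_character Q}. (norm (L \<psi>))\<^sup>2)"
      using L_eq by simp
    also have "\<dots> = n * d - n * t"
      using sum.remove[OF finite_dirichlet_characters[OF Q0] trivial_character_in[OF irr],
          of "\<lambda>\<psi>. (norm (L \<psi>))\<^sup>2"] full n0 by (simp add: t_def)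
    finally have "1 / real (poly_phi Q) *
        (\<Sum>\<psi>\<in>?X - {trivial_character Q}. (norm (dirichlet_L \<psi> (1 / 2)))\<^sup>2) = d - t"
      using n0 by (simp add: phi field_simps)
    \<comment> \<open>The quantity to bound is
      \<open>\<bar>(d - t) - (d - 1)\<bar> = \<bar>1 - t\<bar>\<close>, at most
      \<open>1 + t\<close>.\<close>
    thus ?thesis using t by (simp add: C_def d_def)
  qed
  thus ?thesis by blast
qed

end
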